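(* Let $\mathcal{G}_{12,\mathrm{bip}}$ be the set of all permutations $\pi$ such that the occurrence graph $G_{12}(\pi)$ is bipartite. Then \[ \mathcal{G}_{12,\mathrm{bip}} = \mathrm{Av}(123, 1432, 3214). \]
   Context: Permutations of all lengths $n\ge0$ are considered. For a permutation $\pi$ of length $n$, $V_{12}(\pi)$ is the set of pairs $\{i,j\}$ with $1\le i<j\le n$ and $\pi(i)<\pi(j)$, and the occurrence graph $G_{12}(\pi)$ is the simple undirected graph with vertex set $V_{12}(\pi)$ in which two vertices are adjacent iff they share exactly one element. A graph is bipartite if its vertices can be colored with two colors so that no edge joins two vertices of the same color. A permutation $\pi$ of length $n$ contains a permutation $q$ of length $k$ if there are indices $i_1<\dots<i_k$ with $\pi(i_1)\cdots\pi(i_k)$ order-isomorphic to $q$, and avoids $q$ otherwise; $\mathrm{Av}(M)$ is the set of permutations avoiding every element of $M$. *)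

theory Defs
  imports "HOL-Combinatorics.Multiset_Permutations"
begin

text \<open>
  Permutations of length \<open>n\<close> are words in one-line notation, i.e. lists in
  \<open>permutations_of_set {1..n}\<close>; positions are numbered from 1.
\<close>

definition perms :: "nat list set" where
  "perms = (\<Union>n. permutations_of_set {1..n})"

definition entry :: "nat list \<Rightarrow> nat \<Rightarrow> nat" where
  "entry \<pi> i = \<pi> ! (i - 1)"

definition order_isomorphic :: "nat list \<Rightarrow> nat list \<Rightarrow> bool" where
  "order_isomorphic xs ys \<longleftrightarrow>
     length xs = length ys \<and>
     (\<forall>a\<in>{1..length xs}. \<forall>b\<in>{1..length xs}.
        entry xs a < entry xs b \<longleftrightarrow> entry ys a < entry ys b)"

definition contains_pattern :: "nat list \<Rightarrow> nat list \<Rightarrow> bool" where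
  "contains_pattern \<pi> q \<longleftrightarrow>
     (\<exists>is. length is = length q \<and> sorted_wrt (<) is \<and> set is \<subseteq> {1..length \<pi>} \<and>
           order_isomorphic (map (entry \<pi>) is) q)"

definition Av :: "nat list set \<Rightarrow> nat list set" where
  "Av M = {\<pi> \<in> perms. \<forall>q\<in>M. \<not> contains_pattern \<pi> q}"

text \<open>A simple undirected graph is a pair of a vertex set and a set of two-element
  sets of vertices.\<close>

type_synonym 'v graph = "'v set \<times> 'v set set"

definition bipartite :: "'v graph \<Rightarrow> bool" where
  "bipartite G \<longleftrightarrow>
     (\<exists>c :: 'v \<Rightarrow> bool. \<forall>u\<in>fst G. \<forall>v\<in>fst G. {u, v} \<in> snd G \<longrightarrow> c u \<noteq> c v)"

definition V12 :: "nat list \<Rightarrow> nat set set" where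
  "V12 \<pi> = {{i, j} | i j. 1 \<le> i \<and> i < j \<and> j \<le> length \<pi> \<and> entry \<pi> i < entry \<pi> j}"

definition G12 :: "nat list \<Rightarrow> nat set graph" where
  "G12 \<pi> = (V12 \<pi>, {{u, v} | u v. u \<in> V12 \<pi> \<and> v \<in> V12 \<pi> \<and> card (u \<inter> v) = 1})"

text \<open>Elements of \<^const>\<open>V12\<close> have two elements, so \<open>card (u \<inter> v) = 1\<close> forces
  \<open>u \<noteq> v\<close>: the graph has no loops.\<close>

definition G12_bip :: "nat list set" where
  "G12_bip = {\<pi> \<in> perms. bipartite (G12 \<pi>)}"

end

theory Submission
  imports Defs
begin

text \<open>
  \<open>G12 \<pi>\<close> is the line graph of the graph \<open>H\<close> of non-inversions on positions. Each of the
  three patterns yields three edges of \<open>H\<close> that pairwise meet in one point: a triangle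
  for \<open>123\<close>, a star for \<open>1432\<close> and \<open>3214\<close>. Conversely, if \<open>123\<close> is avoided, every position
  is a left end only, a right end only, or isolated in \<open>H\<close>, and the entries at left ends
  (respectively right ends) decrease. So the neighbours of a left end are consecutive among
  the right ends and vice versa, and there are at most two of them when \<open>1432\<close> and \<open>3214\<close>
  are avoided as well. Colouring an edge by the parity of the rank of its left end among the
  left ends plus the rank of its right end among the right ends is then proper.
\<close>

text \<open>The edges of \<open>H\<close>, oriented from left end to right end; the two-element sets
  in \<open>V12\<close> forget this orientation.\<close>

definition noninv :: "nat list \<Rightarrow> nat \<Rightarrow> nat \<Rightarrow> bool" where
  "noninv \<pi> i j \<longleftrightarrow> 1 \<le> i \<and> i < j \<and> j \<le> length \<pi> \<and> entry \<pi> i < entry \<pi> j"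

text \<open>Consecutive positions satisfying \<open>P\<close> get consecutive values, so their
  parities alternate.\<close>

definition rank :: "(nat \<Rightarrow> bool) \<Rightarrow> nat \<Rightarrow> nat" where
  "rank P j = card {k. k \<le> j \<and> P k}"

lemma rank_next:
  assumes "j < j'" and "P j'" and "\<And>k. j < k \<Longrightarrow> k < j' \<Longrightarrow> \<not> P k"
  shows "rank P j' = Suc (rank P j)"
proof -
  have "{k. k \<le> j' \<and> P k} = insert j' {k. k \<le> j \<and> P k}"
    (is "?A = ?B")
  proof (rule set_eqI)
    fix k show "k \<in> ?A \<longleftrightarrow> k \<in> ?B"
      using assms(1,2) assms(3)[of k] by (cases "k = j'"; cases "j < k") auto
  qed
  then show ?thesis
    using assms(1) by (simp add: rank_def)
qed

section \<open>Adjacency in the occurrence graph\<close>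

lemma V12_eq: "V12 \<pi> = {{i, j} | i j. noninv \<pi> i j}"
  by (simp add: V12_def noninv_def)

lemma noninvI_V12: "noninv \<pi> i j \<Longrightarrow> {i, j} \<in> V12 \<pi>"
  by (auto simp: V12_eq)

lemma edge_G12_iff:
  "u \<in> V12 \<pi> \<Longrightarrow> v \<in> V12 \<pi> \<Longrightarrow> {u, v} \<in> snd (G12 \<pi>) \<longleftrightarrow> card (u \<inter> v) = 1"
  by (auto simp: G12_def doubleton_eq_iff Int_commute)

lemma bipartite_G12_iff:
  "bipartite (G12 \<pi>) \<longleftrightarrow>
     (\<exists>c :: nat set \<Rightarrow> bool. \<forall>u\<in>V12 \<pi>. \<forall>v\<in>V12 \<pi>. card (u \<inter> v) = 1 \<longrightarrow> c u \<noteq> c v)"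
proof -
  have "fst (G12 \<pi>) = V12 \<pi>"
    by (simp add: G12_def)
  then show ?thesis
    by (simp add: bipartite_def edge_G12_iff cong: ball_cong)
qed

text \<open>Pigeonhole: two colours cannot separate three pairwise adjacent vertices.\<close>

lemma not_bipartite_triangle:
  assumes "u \<in> V12 \<pi>" "v \<in> V12 \<pi>" "w \<in> V12 \<pi>"
    and "card (u \<inter> v) = 1" "card (u \<inter> w) = 1" "card (v \<inter> w) = 1"
  shows "\<not> bipartite (G12 \<pi>)"
  unfolding bipartite_G12_iff using assms by blast

section \<open>Patterns in terms of non-inversions\<close>

lemma order_isomorphic_iff_nth:
  "order_isomorphic xs ys \<longleftrightarrow>
     length xs = length ys \<and>
     (\<forall>a<length xs. \<forall>b<length xs. xs ! a < xs ! b \<longleftrightarrow> ys ! a < ys ! b)"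
proof -
  have "{1..n} = Suc ` {..<n}" for n
    by (simp add: image_Suc_lessThan)
  then show ?thesis
    unfolding order_isomorphic_def entry_def by (simp add: ball_simps(9) lessThan_iff Ball_def[of "{..<_}"])
qed

text \<open>The comparison of the outer two entries follows by transitivity, so \<open>123\<close>
  is a directed path of length two in \<open>H\<close>.\<close>

lemma contains_123_iff:
  "contains_pattern \<pi> [1, 2, 3] \<longleftrightarrow> (\<exists>a b c. noninv \<pi> a b \<and> noninv \<pi> b c)"
proof
  assume "contains_pattern \<pi> [1, 2, 3]"
  then obtain "is" where *: "length is = length [1::nat, 2, 3]" "sorted_wrt (<) is"
    "set is \<subseteq> {1..length \<pi>}" "order_isomorphic (map (entry \<pi>) is) [1, 2, 3]"
    unfolding contains_pattern_def by blast
  then obtain a b c where "is = [a, b, c]"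
    by (auto simp: length_Suc_conv)
  then show "\<exists>a b c. noninv \<pi> a b \<and> noninv \<pi> b c"
    using * by (intro exI[of _ a] exI[of _ b] exI[of _ c])
      (auto simp: order_isomorphic_iff_nth All_less_Suc noninv_def)
next
  assume "\<exists>a b c. noninv \<pi> a b \<and> noninv \<pi> b c"
  then obtain a b c where "noninv \<pi> a b" "noninv \<pi> b c" by blast
  then show "contains_pattern \<pi> [1, 2, 3]"
    unfolding contains_pattern_def
    by (intro exI[of _ "[a, b, c]"])
      (auto simp: order_isomorphic_iff_nth All_less_Suc noninv_def)
qed

text \<open>The chain \<open>entry \<pi> a < entry \<pi> d < entry \<pi> c < entry \<pi> b\<close>
  fixes the whole pattern; \<open>noninv \<pi> a d\<close> also supplies the bounds on the outermost
  positions.\<close>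

lemma contains_1432_iff:
  "contains_pattern \<pi> [1, 4, 3, 2] \<longleftrightarrow>
     (\<exists>a b c d. a < b \<and> b < c \<and> noninv \<pi> a d \<and> c < d \<and>
        entry \<pi> d < entry \<pi> c \<and> entry \<pi> c < entry \<pi> b)"
proof
  assume "contains_pattern \<pi> [1, 4, 3, 2]"
  then obtain "is" where *: "length is = length [1::nat, 4, 3, 2]" "sorted_wrt (<) is"
    "set is \<subseteq> {1..length \<pi>}" "order_isomorphic (map (entry \<pi>) is) [1, 4, 3, 2]"
    unfolding contains_pattern_def by blast
  then obtain a b c d where "is = [a, b, c, d]"
    by (auto simp: length_Suc_conv)
  then show "\<exists>a b c d. a < b \<and> b < c \<and> noninv \<pi> a d \<and> c < d \<and>
        entry \<pi> d < entry \<pi> c \<and> entry \<pi> c < entry \<pi> b"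
    using * by (intro exI[of _ a] exI[of _ b] exI[of _ c] exI[of _ d])
      (auto simp: order_isomorphic_iff_nth All_less_Suc noninv_def)
next
  assume "\<exists>a b c d. a < b \<and> b < c \<and> noninv \<pi> a d \<and> c < d \<and>
        entry \<pi> d < entry \<pi> c \<and> entry \<pi> c < entry \<pi> b"
  then obtain a b c d where "a < b" "b < c" "noninv \<pi> a d" "c < d"
    "entry \<pi> d < entry \<pi> c" "entry \<pi> c < entry \<pi> b" by blast
  then show "contains_pattern \<pi> [1, 4, 3, 2]"
    unfolding contains_pattern_def
    by (intro exI[of _ "[a, b, c, d]"])
      (auto simp: order_isomorphic_iff_nth All_less_Suc noninv_def)
qed

text \<open>Here the chain is \<open>entry \<pi> c < entry \<pi> b < entry \<pi> a < entry \<pi>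
  d\<close>.\<close>

lemma contains_3214_iff:
  "contains_pattern \<pi> [3, 2, 1, 4] \<longleftrightarrow>
     (\<exists>a b c d. a < b \<and> b < c \<and> noninv \<pi> a d \<and> c < d \<and>
        entry \<pi> c < entry \<pi> b \<and> entry \<pi> b < entry \<pi> a)"
proof
  assume "contains_pattern \<pi> [3, 2, 1, 4]"
  then obtain "is" where *: "length is = length [3::nat, 2, 1, 4]" "sorted_wrt (<) is"
    "set is \<subseteq> {1..length \<pi>}" "order_isomorphic (map (entry \<pi>) is) [3, 2, 1, 4]"
    unfolding contains_pattern_def by blast
  then obtain a b c d where "is = [a, b, c, d]"
    by (auto simp: length_Suc_conv)
  then show "\<exists>a b c d. a < b \<and> b < c \<and> noninv \<pi> a d \<and> c < d \<and>
        entry \<pi> c < entry \<pi> b \<and> entry \<pi> b < entry \<pi> a"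
    using * by (intro exI[of _ a] exI[of _ b] exI[of _ c] exI[of _ d])
      (auto simp: order_isomorphic_iff_nth All_less_Suc noninv_def)
next
  assume "\<exists>a b c d. a < b \<and> b < c \<and> noninv \<pi> a d \<and> c < d \<and>
        entry \<pi> c < entry \<pi> b \<and> entry \<pi> b < entry \<pi> a"
  then obtain a b c d where "a < b" "b < c" "noninv \<pi> a d" "c < d"
    "entry \<pi> c < entry \<pi> b" "entry \<pi> b < entry \<pi> a" by blast
  then show "contains_pattern \<pi> [3, 2, 1, 4]"
    unfolding contains_pattern_def
    by (intro exI[of _ "[a, b, c, d]"])
      (auto simp: order_isomorphic_iff_nth All_less_Suc noninv_def)
qed

section \<open>Triangles in the occurrence graph forced by the patterns\<close>

lemma contains_123_not_bipartite:
  assumes "contains_pattern \<pi> [1, 2, 3]"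
  shows "\<not> bipartite (G12 \<pi>)"
proof -
  obtain a b c where "noninv \<pi> a b" "noninv \<pi> b c"
    using assms unfolding contains_123_iff by blast
  then show ?thesis
    by (intro not_bipartite_triangle[of "{a, b}" _ "{a, c}" "{b, c}"] noninvI_V12)
      (auto simp: noninv_def Int_insert_left)
qed

lemma contains_1432_not_bipartite:
  assumes "contains_pattern \<pi> [1, 4, 3, 2]"
  shows "\<not> bipartite (G12 \<pi>)"
proof -
  obtain a b c d where "a < b" "b < c" "noninv \<pi> a d" "c < d"
    "entry \<pi> d < entry \<pi> c" "entry \<pi> c < entry \<pi> b"
    using assms unfolding contains_1432_iff by blast
  then show ?thesis
    \<comment> \<open>The star in \<open>H\<close> centred at the smallest entry.\<close>
    by (intro not_bipartite_triangle[of "{a, b}" _ "{a, c}" "{a, d}"] noninvI_V12)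
      (auto simp: noninv_def Int_insert_left)
qed

lemma contains_3214_not_bipartite:
  assumes "contains_pattern \<pi> [3, 2, 1, 4]"
  shows "\<not> bipartite (G12 \<pi>)"
proof -
  obtain a b c d where "a < b" "b < c" "noninv \<pi> a d" "c < d"
    "entry \<pi> c < entry \<pi> b" "entry \<pi> b < entry \<pi> a"
    using assms unfolding contains_3214_iff by blast
  then show ?thesis
    \<comment> \<open>The star in \<open>H\<close> centred at the largest entry.\<close>
    by (intro not_bipartite_triangle[of "{a, d}" _ "{b, d}" "{c, d}"] noninvI_V12)
      (auto simp: noninv_def Int_insert_left)
qed

section \<open>Proper colouring under avoidance\<close>

lemma entry_eq_iff:
  assumes "distinct \<pi>" "1 \<le> i" "i \<le> length \<pi>" "1 \<le> j" "j \<le> length \<pi>"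
  shows "entry \<pi> i = entry \<pi> j \<longleftrightarrow> i = j"
  using assms by (auto simp: entry_def nth_eq_iff_index_eq)

text \<open>An ascent from \<open>j\<close> to \<open>l\<close> would prolong
  \<open>noninv \<pi> i j\<close> to an occurrence of \<open>123\<close> at \<open>i\<close>,
  \<open>j\<close>, \<open>l\<close>.\<close>

lemma right_ends_decreasing:
  assumes "distinct \<pi>" "\<not> contains_pattern \<pi> [1, 2, 3]"
    and "noninv \<pi> i j" "noninv \<pi> k l" "j < l"
  shows "entry \<pi> l < entry \<pi> j"
proof -
  have "entry \<pi> j \<noteq> entry \<pi> l"
    using assms by (subst entry_eq_iff) (auto simp: noninv_def)
  moreover have "\<not> noninv \<pi> j l"
    using assms unfolding contains_123_iff by blast
  ultimately show ?thesis
    using assms by (auto simp: noninv_def)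
qed

text \<open>An ascent from \<open>i\<close> to \<open>k\<close> would precede
  \<open>noninv \<pi> k l\<close> and give \<open>123\<close> at \<open>i\<close>, \<open>k\<close>,
  \<open>l\<close>.\<close>

lemma left_ends_decreasing:
  assumes "distinct \<pi>" "\<not> contains_pattern \<pi> [1, 2, 3]"
    and "noninv \<pi> i j" "noninv \<pi> k l" "i < k"
  shows "entry \<pi> k < entry \<pi> i"
proof -
  have "entry \<pi> i \<noteq> entry \<pi> k"
    using assms by (subst entry_eq_iff) (auto simp: noninv_def)
  moreover have "\<not> noninv \<pi> i k"
    using assms unfolding contains_123_iff by blast
  ultimately show ?thesis
    using assms by (auto simp: noninv_def)
qed

text \<open>A right end \<open>l\<close> strictly between \<open>j\<close> and \<open>j'\<close>,
  whatever its left end, has an entry between theirs, so \<open>i\<close>, \<open>j\<close>,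
  \<open>l\<close>, \<open>j'\<close> would form \<open>1432\<close>.\<close>

lemma rank_right_ends:
  assumes "distinct \<pi>" "\<not> contains_pattern \<pi> [1, 2, 3]" "\<not> contains_pattern \<pi> [1, 4, 3, 2]"
    and "noninv \<pi> i j" "noninv \<pi> i j'" "j < j'"
  shows "rank (\<lambda>l. \<exists>k. noninv \<pi> k l) j' = Suc (rank (\<lambda>l. \<exists>k. noninv \<pi> k l) j)"
proof (rule rank_next)
  fix l assume l: "j < l" "l < j'"
  show "\<not> (\<exists>k. noninv \<pi> k l)"
  proof
    assume "\<exists>k. noninv \<pi> k l"
    then obtain k where "noninv \<pi> k l" by blast
    then have "entry \<pi> j' < entry \<pi> l" "entry \<pi> l < entry \<pi> j"
      using assms l right_ends_decreasing by blast+
    moreover have "i < j"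
      using assms by (simp add: noninv_def)
    ultimately show False
      using assms(3,5) l unfolding contains_1432_iff by blast
  qed
qed (use assms in blast)+

text \<open>Mirror image: a left end \<open>k\<close> strictly between \<open>i\<close> and
  \<open>i'\<close> would make \<open>i\<close>, \<open>k\<close>, \<open>i'\<close>,
  \<open>j\<close> an occurrence of \<open>3214\<close>.\<close>

lemma rank_left_ends:
  assumes "distinct \<pi>" "\<not> contains_pattern \<pi> [1, 2, 3]" "\<not> contains_pattern \<pi> [3, 2, 1, 4]"
    and "noninv \<pi> i j" "noninv \<pi> i' j" "i < i'"
  shows "rank (\<lambda>k. \<exists>l. noninv \<pi> k l) i' = Suc (rank (\<lambda>k. \<exists>l. noninv \<pi> k l) i)"
proof (rule rank_next)
  fix k assume k: "i < k" "k < i'"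
  show "\<not> (\<exists>l. noninv \<pi> k l)"
  proof
    assume "\<exists>l. noninv \<pi> k l"
    then obtain l where "noninv \<pi> k l" by blast
    then have "entry \<pi> i' < entry \<pi> k" "entry \<pi> k < entry \<pi> i"
      using assms k left_ends_decreasing by blast+
    moreover have "i' < j"
      using assms by (simp add: noninv_def)
    ultimately show False
      using assms(3,4) k unfolding contains_3214_iff by blast
  qed
qed (use assms in blast)+

lemma bipartite_if_avoids:
  assumes "distinct \<pi>" "\<not> contains_pattern \<pi> [1, 2, 3]"
    "\<not> contains_pattern \<pi> [1, 4, 3, 2]" "\<not> contains_pattern \<pi> [3, 2, 1, 4]"
  shows "bipartite (G12 \<pi>)"
proof -
  let ?L = "rank (\<lambda>k. \<exists>l. noninv \<pi> k l)" and ?R = "rank (\<lambda>l. \<exists>k. noninv \<pi> k l)"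
  \<comment> \<open>\<open>Min\<close> and \<open>Max\<close> recover the left and right end from
    the unordered pair.\<close>
  let ?c = "\<lambda>u. even (?L (Min u) + ?R (Max u))"
  have "?c u \<noteq> ?c v" if uv: "u \<in> V12 \<pi>" "v \<in> V12 \<pi>" "card (u \<inter> v) = 1" for u v
  proof -
    obtain i j k l where u: "u = {i, j}" "noninv \<pi> i j" and v: "v = {k, l}" "noninv \<pi> k l"
      using uv(1,2) unfolding V12_eq by blast
    have "i < j" "k < l"
      using u v by (auto simp: noninv_def)
    then have c: "?c u = even (?L i + ?R j)" "?c v = even (?L k + ?R l)"
      using u v by (simp_all add: min_def max_def)
    \<comment> \<open>No position is both a left and a right end, so a single shared point is a
      common left end or a common right end.\<close>
    have "j \<noteq> k" "i \<noteq> l"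
      using u v assms(2) unfolding contains_123_iff by blast+
    with uv(3) \<open>i < j\<close> \<open>k < l\<close> consider "i = k" "j \<noteq> l" | "j = l" "i \<noteq> k"
      unfolding u v by (cases "i = k"; cases "j = l") (auto simp: Int_insert_left)
    then show ?thesis
    proof cases
      case 1
      \<comment> \<open>Either of \<open>j\<close> and \<open>l\<close> may come first. The summands
        \<open>?L i\<close> and \<open>?L k\<close> agree, so the parity of the sum flips.\<close>
      then have "?R j = Suc (?R l) \<or> ?R l = Suc (?R j)"
        using rank_right_ends[OF assms(1-3)] u v by (metis nat_neq_iff)
      then show ?thesis unfolding c using 1 by auto
    next
      case 2
      then have "?L i = Suc (?L k) \<or> ?L k = Suc (?L i)"
        using rank_left_ends[OF assms(1,2,4)] u v by (metis nat_neq_iff)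
      then show ?thesis unfolding c using 2 by auto
    qed
  qed
  then show ?thesis
    unfolding bipartite_G12_iff by (intro exI[of _ ?c]) blast
qed

theorem theorem5p4:
  "G12_bip = Av {[1, 2, 3], [1, 4, 3, 2], [3, 2, 1, 4]}"
proof -
  have "distinct \<pi>" if "\<pi> \<in> perms" for \<pi>
    using that by (auto simp: perms_def permutations_of_set_def)
  then show ?thesis
    unfolding G12_bip_def Av_def ball_simps
    \<comment> \<open>\<open>conj_cong\<close> keeps \<open>\<pi> \<in> perms\<close> at hand, which
      gives the distinctness that the colouring requires.\<close>
    by (intro Collect_cong conj_cong refl iffI conjI TrueI)
      (use bipartite_if_avoids contains_123_not_bipartite contains_1432_not_bipartite
        contains_3214_not_bipartite in blast)+
qed

end
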